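(* Let $n>1$ be odd and let $s$ be an integer with $0\le s\le (n-1)/2$. If $$M\in\left\{\frac{n-1}{2},\ n-s-1,\ n-1\right\},$$ then $$\sum_{k=s}^{M}\mathcal{T}_{s,k}(q)\equiv 0\pmod{[n]},$$ where, for $k\ge s$, $$\mathcal{T}_{s,k}(q)=(-1)^k[4k+1]\,q^k\,\frac{(q;q^2)_{k-s}\,(q;q^2)_{k+s}\,(q;q^2)_k^2\,(q^2;q^4)_k}{(q^2;q^2)_{k-s}\,(q^2;q^2)_{k+s}\,(q^2;q^2)_k^2\,(q^4;q^4)_k}.$$
   Context: Here $q$ is an indeterminate. For $m\ge 1$, $[m]=[m]_q=\frac{1-q^m}{1-q}$. For $N\ge 0$, $(a;q)_0=1$ and $(a;q)_N=\prod_{j=0}^{N-1}(1-aq^j)$; thus for example $(q;q^2)_N=\prod_{j=0}^{N-1}(1-q^{2j+1})$ and $(q^2;q^4)_N=\prod_{j=0}^{N-1}(1-q^{4j+2})$. Congruences of rational functions are understood in the reduced-denominator sense: if $F(q)=P(q)/Q(q)$ with $P,Q\in\mathbb{Q}[q]$, $\gcd(P,Q)=1$, and $Q$ is relatively prime to $M(q)$, then $F(q)\equiv 0\pmod{M(q)}$ means that $M(q)$ divides $P(q)$ in $\mathbb{Q}[q]$. (The congruence thus includes the assertion that the reduced denominator of the whole sum is relatively prime to $[n]$.) *)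

theory Defs
  imports
    "HOL-Computational_Algebra.Computational_Algebra"
    "HOL-Computational_Algebra.Field_as_Ring"
begin

text \<open>
  Rational functions over the rationals are elements of the field \<^typ>\<open>rat poly fract\<close>;
  the indeterminate is \<open>[:0, 1:]\<close> as a polynomial and \<open>to_fract [:0, 1:]\<close> as a rational function.
\<close>

abbreviation q_var :: "rat poly fract" where
  "q_var \<equiv> to_fract [:0, 1:]"

text \<open>
  The type class admits both fields, where the division is the field division, and polynomial
  rings, where it is exact (lemma \<open>to_fract_q_bracket\<close>).
\<close>

definition q_bracket :: "'a :: idom_divide \<Rightarrow> nat \<Rightarrow> 'a" where
  "q_bracket q m = (1 - q ^ m) div (1 - q)"

definition q_poch :: "'a :: comm_ring_1 \<Rightarrow> 'a \<Rightarrow> nat \<Rightarrow> 'a" where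
  "q_poch a q N = (\<Prod>j<N. 1 - a * q ^ j)"

text \<open>
  The existential over reduced representations is harmless: any reduced representation gives the
  same answer (lemma \<open>ratfun_cong_0_iff\<close>). Coprimality of \<open>Q\<close> and \<open>M\<close> is part of the congruence.
\<close>

definition ratfun_cong_0 :: "rat poly fract \<Rightarrow> rat poly \<Rightarrow> bool" where
  "ratfun_cong_0 F M \<longleftrightarrow>
     (\<exists>P Q. Q \<noteq> 0 \<and> F = to_fract P / to_fract Q \<and> coprime P Q \<and> coprime Q M \<and> M dvd P)"

text \<open>
  Only meaningful for \<open>s \<le> k\<close>, since \<open>k - s\<close> is truncated subtraction on natural numbers.
\<close>

definition T_term :: "nat \<Rightarrow> nat \<Rightarrow> 'a :: field \<Rightarrow> 'a" where
  "T_term s k q =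
     (-1) ^ k * q_bracket q (4 * k + 1) * q ^ k *
     ((q_poch q (q^2) (k - s) * q_poch q (q^2) (k + s) * (q_poch q (q^2) k)^2 * q_poch (q^2) (q^4) k) /
      (q_poch (q^2) (q^2) (k - s) * q_poch (q^2) (q^2) (k + s) * (q_poch (q^2) (q^2) k)^2 *
       q_poch (q^4) (q^4) k))"

lemma q_bracket_poly: "q_bracket [:0, 1 :: rat:] m = (\<Sum>i<m. [:0, 1:] ^ i)"
proof -
  have "1 - [:0, 1 :: rat:] ^ m = (1 - [:0, 1:]) * (\<Sum>i<m. [:0, 1:] ^ i)"
    by (rule one_diff_power_eq)
  moreover have "1 - [:0, 1 :: rat:] \<noteq> 0"
    by (simp add: one_pCons)
  ultimately show ?thesis
    by (simp only: q_bracket_def nonzero_mult_div_cancel_left not_False_eq_True)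
qed

lemma to_fract_q_bracket: "to_fract (q_bracket [:0, 1 :: rat:] m) = q_bracket q_var m"
proof -
  let ?x = "[:0, 1 :: rat:]"
  have ne: "1 - ?x \<noteq> 0"
    by (simp add: one_pCons)
  have pw: "to_fract (?x ^ m) = q_var ^ m"
    by (induction m) (simp_all only: power_0 power_Suc to_fract_1 to_fract_mult)
  have "(1 - ?x) * q_bracket ?x m = 1 - ?x ^ m"
    unfolding q_bracket_poly by (rule one_diff_power_eq [symmetric])
  then have "to_fract (1 - ?x) * to_fract (q_bracket ?x m) = to_fract (1 - ?x ^ m)"
    by (simp only: to_fract_mult [symmetric])
  then have *: "(1 - q_var) * to_fract (q_bracket ?x m) = 1 - q_var ^ m"
    by (simp only: to_fract_diff to_fract_1 pw)
  have "to_fract (1 - ?x) \<noteq> 0"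
    using ne by (simp only: to_fract_eq_0_iff not_False_eq_True)
  then have "1 - q_var \<noteq> 0"
    by (simp only: to_fract_diff to_fract_1 not_False_eq_True)
  then have "to_fract (q_bracket ?x m) = ((1 - q_var) * to_fract (q_bracket ?x m)) div (1 - q_var)"
    by (rule nonzero_mult_div_cancel_left [symmetric])
  then show ?thesis
    by (simp only: * q_bracket_def [of q_var])
qed

lemma ratfun_cong_0_iff:
  assumes "Q \<noteq> 0" "coprime P Q" "F = to_fract P / to_fract Q"
  shows "ratfun_cong_0 F M \<longleftrightarrow> coprime Q M \<and> M dvd P"
proof
  assume "ratfun_cong_0 F M"
  then obtain P' Q' where
    1: "Q' \<noteq> 0" "F = to_fract P' / to_fract Q'" "coprime P' Q'" "coprime Q' M" "M dvd P'"
    unfolding ratfun_cong_0_def by blast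
  have "to_fract P * to_fract Q' = to_fract P' * to_fract Q"
    using assms(1,3) 1(1,2) frac_eq_eq [of "to_fract Q" "to_fract Q'" "to_fract P" "to_fract P'"]
    by (simp only: to_fract_eq_0_iff not_False_eq_True simp_thms)
  then have eq: "P * Q' = P' * Q"
    by (simp only: to_fract_mult [symmetric] to_fract_eq_iff)
  have "Q dvd P * Q'"
    unfolding eq by (rule dvd_triv_right)
  then have "Q dvd Q'"
    by (rule coprime_dvd_mult_right_iff [OF assms(2) [unfolded coprime_commute [of P]], THEN iffD1])
  then have "coprime Q M"
    by (rule coprime_divisors [OF _ dvd_refl 1(4)])
  moreover have "P' dvd P * Q'"
    unfolding eq by (rule dvd_triv_left)
  then have "P' dvd P"
    by (rule coprime_dvd_mult_left_iff [OF 1(3), THEN iffD1])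
  then have "M dvd P"
    by (rule dvd_trans [OF 1(5)])
  ultimately show "coprime Q M \<and> M dvd P"
    by blast
next
  assume "coprime Q M \<and> M dvd P"
  then show "ratfun_cong_0 F M"
    unfolding ratfun_cong_0_def using assms by blast
qed

end

theory Submission
  imports Defs
begin

text \<open>
  Write \<open>A m = (q;q\<^sup>2)\<^sub>m / (q\<^sup>2;q\<^sup>2)\<^sub>m\<close> as the central Gaussian binomial of \<open>2m\<close> over the square of
  \<open>(1 + q) \<dots> (1 + q ^ m)\<close>. Hence each summand is regular at every root of unity \<open>z\<close> of odd
  order \<open>d = 2h + 1\<close>, and the q-Lucas theorem gives \<open>A (d u + c) = \<alpha> u * A c\<close> at \<open>q = z\<close>, with
  \<open>A c = 0\<close> for \<open>h < c < d\<close>. With \<open>s = d v + t\<close>, \<open>\<bar>t\<bar> \<le> h\<close>, the sum therefore splits into blocks of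
  length \<open>d\<close>, each a multiple of the sum with \<open>s\<close> replaced by \<open>t\<close> over \<open>0 \<le> k \<le> h\<close>, and each of the
  three upper limits cuts the range only where the summand vanishes. The reflection
  \<open>A (h - c) = A h * z ^ c * A c\<close> makes the block sum antisymmetric under \<open>k \<mapsto> h - k\<close>, so it is \<open>0\<close>.
  Thus the numerator vanishes at all complex roots of \<open>[n]\<close>, which are simple, while the common
  denominator is coprime to \<open>[n]\<close> because \<open>1 + q ^ j\<close> divides \<open>1 + q ^ (j n)\<close> for odd \<open>n\<close>.
\<close>

section \<open>Gaussian binomials and q-shifted factorials\<close>

text \<open>The q-Pascal recursion avoids division: the coefficient exists over polynomial rings,
  keeps its meaning at roots of unity, and commutes with ring homomorphisms.\<close>

fun gbin :: "'a::comm_ring_1 \<Rightarrow> nat \<Rightarrow> nat \<Rightarrow> 'a" where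
  "gbin q n 0 = 1"
| "gbin q 0 (Suc k) = 0"
| "gbin q (Suc n) (Suc k) = gbin q n k + q ^ Suc k * gbin q n (Suc k)"

definition one_plus_prod :: "'a::comm_ring_1 \<Rightarrow> nat \<Rightarrow> 'a" where
  "one_plus_prod q m = (\<Prod>j<m. 1 + q ^ Suc j)"

text \<open>A q-analogue of binom(2m,m)/4^m, which stays meaningful at roots of unity where both
  q-shifted factorials vanish.\<close>

definition cbin_ratio :: "'a::field \<Rightarrow> nat \<Rightarrow> 'a" where
  "cbin_ratio q m = gbin q (2 * m) m / (one_plus_prod q m)\<^sup>2"

text \<open>
  The extension by zero to negative arguments makes the summand even in \<open>s\<close>, which permits negative
  residues of \<open>s\<close> modulo the order of the root of unity.
\<close>

definition cbin_ratio_int :: "'a::field \<Rightarrow> int \<Rightarrow> 'a" where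
  "cbin_ratio_int q c = (if c < 0 then 0 else cbin_ratio q (nat c))"

lemma q_poch_0 [simp]: "q_poch a q 0 = 1"
  and q_poch_Suc: "q_poch a q (Suc n) = q_poch a q n * (1 - a * q ^ n)"
  by (simp_all add: q_poch_def mult.commute)

lemma one_plus_prod_0 [simp]: "one_plus_prod q 0 = 1"
  and one_plus_prod_Suc: "one_plus_prod q (Suc n) = one_plus_prod q n * (1 + q ^ Suc n)"
  by (simp_all add: one_plus_prod_def mult.commute)

lemma gbin_eq_0: "n < k \<Longrightarrow> gbin q n k = 0"
  by (induction q n k rule: gbin.induct) auto

lemma gbin_self [simp]: "gbin q n n = 1"
  by (induction n) (simp_all add: gbin_eq_0)

text \<open>Of the two q-Pascal terms, one has smaller \<open>k\<close> and falls to the outer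
  induction, the other has smaller \<open>m\<close> and falls to the inner one.\<close>

lemma gbin_q_poch: "gbin q (m + k) k * q_poch q q k * q_poch q q m = q_poch q q (m + k)"
proof (induction k arbitrary: m)
  case 0
  then show ?case by simp
next
  case (Suc k)
  show ?case
  proof (induction m)
    case 0
    then show ?case by simp
  next
    case IH: (Suc m)
    let ?N = "m + Suc k"
    have 1: "gbin q ?N k * q_poch q q k * q_poch q q (Suc m) = q_poch q q ?N"
      using Suc [of "Suc m"] by simp
    have "gbin q (Suc m + Suc k) (Suc k) * q_poch q q (Suc k) * q_poch q q (Suc m)
      = (gbin q ?N k * q_poch q q k * q_poch q q (Suc m)) * (1 - q ^ Suc k)
        + (gbin q ?N (Suc k) * q_poch q q (Suc k) * q_poch q q m) * (q ^ Suc k * (1 - q ^ Suc m))"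
      by (simp add: q_poch_Suc algebra_simps)
    also have "\<dots> = q_poch q q ?N * (1 - q ^ Suc k + q ^ Suc k * (1 - q ^ Suc m))"
      unfolding 1 IH by (simp add: algebra_simps)
    also have "1 - q ^ Suc k + q ^ Suc k * (1 - q ^ Suc m) = 1 - q * q ^ ?N"
      by (simp add: algebra_simps power_add)
    finally show ?case
      by (simp add: q_poch_Suc)
  qed
qed

lemma q_poch_double: "q_poch q q (2 * m) = q_poch q (q\<^sup>2) m * q_poch (q\<^sup>2) (q\<^sup>2) m"
proof (induction m)
  case (Suc m)
  have "q\<^sup>2 * (q\<^sup>2) ^ m = q * q ^ Suc (2 * m)" "q * (q\<^sup>2) ^ m = q * q ^ (2 * m)"
    by (simp_all add: power_mult power2_eq_square mult.assoc)
  with Suc show ?case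
    by (simp add: q_poch_Suc mult.assoc mult.left_commute)
qed simp

lemma q_poch_square: "q_poch (q\<^sup>2) (q\<^sup>2) m = q_poch q q m * one_plus_prod q m"
proof (induction m)
  case (Suc m)
  have "1 - q\<^sup>2 * (q\<^sup>2) ^ m = (1 - q * q ^ m) * (1 + q ^ Suc m)"
    by (simp add: algebra_simps power2_eq_square power_mult_distrib)
  with Suc show ?case
    by (simp add: q_poch_Suc one_plus_prod_Suc)
qed simp

lemma q_poch_nonzero:
  fixes q :: "'a::idom"
  assumes "\<And>j. 0 < j \<Longrightarrow> j \<le> m \<Longrightarrow> q ^ j \<noteq> 1"
  shows "q_poch q q m \<noteq> 0"
  using assms [of "Suc _"] by (auto simp: q_poch_def)

text \<open>Split the factors of \<open>q_poch q q (2 * m)\<close> into odd and even exponents,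
  compare with the product formula for the central Gaussian binomial, and cancel one
  \<open>q_poch q q m\<close>.\<close>

lemma q_poch_ratio:
  fixes q :: "'a::field"
  assumes "q_poch (q\<^sup>2) (q\<^sup>2) m \<noteq> 0"
  shows "q_poch q (q\<^sup>2) m / q_poch (q\<^sup>2) (q\<^sup>2) m = cbin_ratio q m"
proof -
  have ne: "q_poch q q m \<noteq> 0" "one_plus_prod q m \<noteq> 0"
    using assms by (auto simp: q_poch_square)
  have "gbin q (2 * m) m * (q_poch q q m)\<^sup>2 = q_poch q (q\<^sup>2) m * q_poch (q\<^sup>2) (q\<^sup>2) m"
    using gbin_q_poch [of q m m] unfolding q_poch_double [symmetric]
    by (simp add: power2_eq_square mult_2 mult.assoc)
  then have "q_poch q q m * (gbin q (2 * m) m * q_poch q q m)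
      = q_poch q q m * (q_poch q (q\<^sup>2) m * one_plus_prod q m)"
    by (simp only: q_poch_square power2_eq_square [of "q_poch q q m"] mult_ac)
  then have "gbin q (2 * m) m * q_poch q q m = q_poch q (q\<^sup>2) m * one_plus_prod q m"
    using ne(1) by (simp only: mult_cancel_left simp_thms)
  then have "q_poch q (q\<^sup>2) m * (one_plus_prod q m)\<^sup>2
      = gbin q (2 * m) m * (q_poch q q m * one_plus_prod q m)"
    by (simp only: power2_eq_square [of "one_plus_prod q m"] mult.assoc [symmetric])
  then show ?thesis
    using ne by (simp add: cbin_ratio_def q_poch_square frac_eq_eq)
qed

text \<open>
  The summand in terms of central Gaussian binomials; it is regular wherever no \<open>1 + q ^ j\<close> vanishes.
\<close>

definition binom_term :: "nat \<Rightarrow> nat \<Rightarrow> 'a::field \<Rightarrow> 'a" where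
  "binom_term s k q = (-1) ^ k * (\<Sum>i<4 * k + 1. q ^ i) * q ^ k *
     (cbin_ratio q (k - s) * cbin_ratio q (k + s) * (cbin_ratio q k)\<^sup>2 * cbin_ratio (q\<^sup>2) k)"

text \<open>Intended for the indeterminate, which has infinite order; at a root of unity only the
  right-hand side is evaluated.\<close>

lemma T_term_eq_binom_term:
  fixes q :: "'a::field"
  assumes "\<And>j. 0 < j \<Longrightarrow> q ^ j \<noteq> 1"
  shows "T_term s k q = binom_term s k q"
proof -
  have ne: "q_poch (q\<^sup>2) (q\<^sup>2) m \<noteq> 0" for m
    by (rule q_poch_nonzero) (use assms in \<open>simp flip: power_mult\<close>)
  have 4: "q ^ 4 = (q\<^sup>2)\<^sup>2"
    by (simp flip: power_mult)
  have ne4: "q_poch ((q\<^sup>2)\<^sup>2) ((q\<^sup>2)\<^sup>2) m \<noteq> 0" for m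
    by (rule q_poch_nonzero) (use assms in \<open>simp flip: power_mult\<close>)
  have br: "q_bracket q m = (\<Sum>i<m. q ^ i)" for m
    unfolding q_bracket_def using assms [of 1] by (simp add: one_diff_power_eq)
  show ?thesis
    unfolding T_term_def binom_term_def 4 br q_poch_ratio [OF ne, symmetric]
      q_poch_ratio [OF ne4, symmetric]
    by (simp add: power_divide)
qed

section \<open>Roots of unity of odd order\<close>

text \<open>The equivalence says that \<open>z\<close> has exact order \<open>d\<close>; positivity
  of \<open>h\<close> excludes \<open>z = 1\<close>, so \<open>1 - z\<close> may be a
  denominator.\<close>

locale odd_primitive_root =
  fixes z :: "'a::field_char_0" and h d :: nat
  assumes d_eq: "d = 2 * h + 1"
    and h_pos: "h > 0"
    and power_eq_1_iff: "z ^ j = 1 \<longleftrightarrow> d dvd j"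
begin

lemma z_nonzero: "z \<noteq> 0"
  using power_eq_1_iff [of d] d_eq by auto

text \<open>As \<open>d\<close> is odd, squaring preserves the order. All results about
  \<open>z\<close> thus apply to the factor \<open>cbin_ratio (z\<^sup>2) k\<close>.\<close>

lemma square: "odd_primitive_root (z\<^sup>2) h d"
proof
  fix j
  have "d dvd 2 * j \<longleftrightarrow> d dvd j"
    by (rule coprime_dvd_mult_right_iff) (simp add: d_eq)
  then show "(z\<^sup>2) ^ j = 1 \<longleftrightarrow> d dvd j"
    by (simp add: power_eq_1_iff flip: power_mult)
qed (use d_eq h_pos in auto)

lemma power_mod: "z ^ (k mod d) = z ^ k"
proof -
  have "z ^ k = (z ^ d) ^ (k div d) * z ^ (k mod d)"
    by (simp flip: power_mult power_add)
  then show ?thesis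
    using power_eq_1_iff [of d] by simp
qed

lemma one_plus_power_nonzero: "1 + z ^ j \<noteq> 0"
proof
  assume "1 + z ^ j = 0"
  then have "z ^ j = - 1"
    by (simp add: add_eq_0_iff)
  then have "z ^ (j * d) = - 1"
    by (simp only: power_mult) (simp add: d_eq)
  moreover have "z ^ (j * d) = 1"
    by (simp add: power_eq_1_iff)
  ultimately show False
    by simp
qed

lemma one_plus_prod_nonzero: "one_plus_prod z m \<noteq> 0"
  using one_plus_power_nonzero [of "Suc _"] by (simp add: one_plus_prod_def)

section \<open>The q-Lucas theorem and factorization over blocks of length \<open>d\<close>\<close>

lemma gbin_order_eq_0:
  assumes "0 < c" "c < d"
  shows "gbin z d c = 0"
proof -
  have "gbin z d c * q_poch z z c * q_poch z z (d - c) = q_poch z z d"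
    using gbin_q_poch [of z "d - c" c] assms by simp
  \<comment> \<open>The last factor, at \<open>j = d - 1\<close>, is
    \<open>1 - z ^ d\<close>.\<close>
  moreover have "q_poch z z d = 0"
    using power_eq_1_iff [of d] by (auto simp: q_poch_def d_eq intro!: bexI [of _ "d - 1"])
  moreover have "q_poch z z m \<noteq> 0" if "m < d" for m
    by (rule q_poch_nonzero) (use that in \<open>auto simp: power_eq_1_iff dest: dvd_imp_le\<close>)
  ultimately show ?thesis
    using assms by simp
qed

lemma gbin_lucas:
  "gbin z N k = of_nat ((N div d) choose (k div d)) * gbin z (N mod d) (k mod d)"
proof (induction N arbitrary: k)
  case 0
  show ?case
  proof (cases k)
    case (Suc k')
    have "k div d \<noteq> 0 \<or> k mod d \<noteq> 0"
      using Suc by (metis div_mult_mod_eq add.right_neutral mult_zero_left nat.distinct(1))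
    then have "(0 choose (k div d)) = 0 \<or> gbin z 0 (k mod d) = 0"
      by (metis gbin_eq_0 binomial_eq_0 gr0I)
    then show ?thesis
      using Suc by auto
  qed simp
next
  case (Suc N)
  show ?case
  proof (cases k)
    case k: (Suc k')
    define u b v c where uv: "u = N div d" "b = N mod d" "v = k' div d" "c = k' mod d"
    have lt: "b < d" "c < d"
      by (simp_all add: uv d_eq)
    have eq: "gbin z (Suc N) k
      = of_nat (u choose v) * gbin z b c
        + z ^ Suc k' * (of_nat (u choose (Suc k' div d)) * gbin z b (Suc k' mod d))"
      by (simp only: k gbin.simps Suc.IH [of k'] Suc.IH [of "Suc k'"] uv)
    have pw: "z ^ Suc k' = z ^ (Suc k' mod d)"
      by (simp only: power_mod)
    \<comment> \<open>The cases record whether incrementing \<open>N\<close> or \<open>k'\<close>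
      carries into the quotient by \<open>d\<close>. A double carry gives Pascal's rule for the
      quotients, no carry gives q-Pascal for the residues.\<close>
    consider "Suc b = d" "Suc c = d" | "Suc b = d" "Suc c < d" | "Suc b < d" "Suc c = d"
      | "Suc b < d" "Suc c < d"
      using lt by linarith
    then show ?thesis
    proof cases
      case 1
      then show ?thesis
        unfolding eq pw unfolding k by (auto simp: mod_Suc div_Suc simp flip: uv)
    next
      case 2
      \<comment> \<open>The two q-Pascal terms recombine into a coefficient with upper index
        \<open>d\<close>, which vanishes.\<close>
      have "gbin z (Suc b) (Suc c) = 0"
        using 2 gbin_order_eq_0 [of "Suc c"] by simp
      with 2 show ?thesis
        unfolding eq pw unfolding k
        by (auto simp: mod_Suc div_Suc mult.left_commute simp flip: uv distrib_left)
    next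
      case 3
      then show ?thesis
        unfolding eq pw unfolding k by (auto simp: mod_Suc div_Suc gbin_eq_0 simp flip: uv)
    next
      case 4
      then show ?thesis
        unfolding eq pw unfolding k
        by (auto simp: mod_Suc div_Suc algebra_simps simp flip: uv)
    qed
  qed simp
qed

lemma gbin_lucas_block:
  assumes "b < d" "c < d"
  shows "gbin z (d * u + b) (d * v + c) = of_nat (u choose v) * gbin z b c"
  using assms gbin_lucas [of "d * u + b" "d * v + c"] by simp

lemma one_plus_prod_add: "one_plus_prod z (d + m) = one_plus_prod z d * one_plus_prod z m"
proof (induction m)
  case (Suc m)
  have "z ^ Suc (d + m) = z ^ Suc m"
    using power_eq_1_iff [of d] by (simp add: power_add)
  with Suc show ?case
    by (simp add: one_plus_prod_Suc del: power_Suc)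
qed simp

lemma one_plus_prod_block:
  "one_plus_prod z (d * u + b) = one_plus_prod z d ^ u * one_plus_prod z b"
  by (induction u) (simp_all add: one_plus_prod_add add.assoc mult.assoc)

text \<open>Doubling a residue \<open>b > h\<close> carries and leaves residue
  \<open>2 * b - d < b\<close>, so the residue factor in q-Lucas has its lower index above its upper
  one.\<close>

lemma gbin_central_eq_0:
  assumes "h < b" "b < d"
  shows "gbin z (2 * (d * u + b)) (d * u + b) = 0"
proof -
  have eq: "2 * (d * u + b) = d * (2 * u + 1) + (2 * b - d)" and lt: "2 * b - d < b"
    using assms d_eq by (auto simp: algebra_simps)
  show ?thesis
    unfolding eq using assms lt by (subst gbin_lucas_block) (simp_all add: gbin_eq_0)
qed

lemma cbin_ratio_eq_0: "h < b \<Longrightarrow> b < d \<Longrightarrow> cbin_ratio z b = 0"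
  using gbin_central_eq_0 [of b 0] by (simp add: cbin_ratio_def)

text \<open>Since the product of \<open>1 + z ^ j\<close> over a full period is 2, this equals
  binom(2u,u)/4^u.\<close>

definition block_factor :: "nat \<Rightarrow> 'a" where
  "block_factor u = of_nat (2 * u choose u) / (one_plus_prod z d ^ u)\<^sup>2"

lemma cbin_ratio_block:
  assumes "b < d"
  shows "cbin_ratio z (d * u + b) = block_factor u * cbin_ratio z b"
proof (cases "b \<le> h")
  case True
  have eq: "2 * (d * u + b) = d * (2 * u) + 2 * b"
    by (simp add: algebra_simps)
  have "gbin z (2 * (d * u + b)) (d * u + b) = of_nat (2 * u choose u) * gbin z (2 * b) b"
    unfolding eq by (rule gbin_lucas_block) (use True d_eq in auto)
  then show ?thesis
    by (simp add: cbin_ratio_def block_factor_def one_plus_prod_block power_mult_distrib)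
next
  case False
  then show ?thesis
    using assms gbin_central_eq_0 [of b u] by (simp add: cbin_ratio_eq_0) (simp add: cbin_ratio_def)
qed

definition block_factor_int :: "int \<Rightarrow> 'a" where
  "block_factor_int u = (if u < 0 then 0 else block_factor (nat u))"

lemma cbin_ratio_int_block:
  assumes "- int h \<le> c" "c < int d"
  shows "cbin_ratio_int z (int d * u + c) = block_factor_int u * cbin_ratio_int z c"
proof (cases "c < 0")
  case True
  show ?thesis
  proof (cases "u \<ge> 1")
    case u: True
    have "int d * u + c = int d * (u - 1) + (int d + c)"
      by (simp add: algebra_simps)
    also have "\<dots> = int (d * nat (u - 1) + nat (int d + c))"
      using u assms d_eq by (simp add: distrib_right)
    finally have *: "int d * u + c = \<dots>" .
    \<comment> \<open>A negative residue \<open>c\<close> lands in the preceding block at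
      \<open>d + c\<close>, strictly between \<open>h\<close> and \<open>d\<close>.\<close>
    have "cbin_ratio z (nat (int d + c)) = 0"
      by (rule cbin_ratio_eq_0) (use assms d_eq True in auto)
    moreover have "nat (int d + c) < d"
      using assms d_eq True by auto
    ultimately show ?thesis
      using True unfolding * by (simp add: cbin_ratio_int_def cbin_ratio_block del: of_nat_add of_nat_mult)
  next
    case False
    then have "int d * u \<le> 0"
      by (simp add: mult_nonneg_nonpos)
    then have "int d * u + c < 0"
      using True by linarith
    then show ?thesis
      using True by (simp add: cbin_ratio_int_def)
  qed
next
  case False
  show ?thesis
  proof (cases "u \<ge> 0")
    case True
    then have *: "int d * u + c = int (d * nat u + nat c)"
      using False by simp
    show ?thesis
      using True False assms unfolding *
      by (simp add: cbin_ratio_int_def block_factor_int_def cbin_ratio_block del: of_nat_add of_nat_mult)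
  next
    case u: False
    then have "int d * u \<le> int d * (-1)"
      by (intro mult_left_mono) auto
    then have "int d * u + c < 0"
      using assms by linarith
    then show ?thesis
      using u by (simp add: cbin_ratio_int_def block_factor_int_def)
  qed
qed

section \<open>Reflection of the central ratios\<close>

lemma q_poch_square_nonzero: "m \<le> h \<Longrightarrow> q_poch (z\<^sup>2) (z\<^sup>2) m \<noteq> 0"
  by (rule q_poch_nonzero)
    (auto simp: odd_primitive_root.power_eq_1_iff [OF square] d_eq dest: dvd_imp_le)

lemma cbin_ratio_Suc:
  assumes "k < h"
  shows "cbin_ratio z (Suc k) * (1 - z ^ (2 * k + 2)) = cbin_ratio z k * (1 - z ^ (2 * k + 1))"
proof -
  have ne: "q_poch (z\<^sup>2) (z\<^sup>2) k \<noteq> 0" "q_poch (z\<^sup>2) (z\<^sup>2) (Suc k) \<noteq> 0"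
    using q_poch_square_nonzero [of k] q_poch_square_nonzero [of "Suc k"] assms by auto
  have "(z\<^sup>2) * (z\<^sup>2) ^ k = z ^ (2 * k + 2)" "z * (z\<^sup>2) ^ k = z ^ (2 * k + 1)"
    by (simp_all add: power_mult power_add power2_eq_square)
  with ne show ?thesis
    unfolding q_poch_ratio [OF ne(1), symmetric] q_poch_ratio [OF ne(2), symmetric]
    by (simp add: q_poch_Suc)
qed

text \<open>Induction with \<open>cbin_ratio_Suc\<close> at both ends, \<open>k\<close> and
  \<open>m = h - Suc k\<close>. The exponents of opposite factors add up to \<open>d\<close>, so the
  numerator factor at one end matches the denominator factor at the other up to a power of
  \<open>z\<close>.\<close>

lemma cbin_ratio_reflect:
  assumes "k \<le> h"
  shows "cbin_ratio z (h - k) = cbin_ratio z h * z ^ k * cbin_ratio z k"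
  using assms
proof (induction k)
  case 0
  then show ?case
    by (simp add: cbin_ratio_def)
next
  case (Suc k)
  define m where "m = h - Suc k"
  have m: "h - k = Suc m" "m < h" "2 * m + 1 + (2 * k + 2) = d" "2 * m + 2 + (2 * k + 1) = d"
    using Suc.prems by (auto simp: m_def d_eq)
  have inv: "1 - z ^ i = - (z ^ i) * (1 - z ^ j)" if "i + j = d" for i j
    using that power_eq_1_iff [of d] by (simp add: algebra_simps flip: power_add)
  define E G a where "E = 1 - z ^ (2 * k + 2)" "G = 1 - z ^ (2 * k + 1)" "a = - (z ^ (2 * m + 1))"
  have "E \<noteq> 0"
    unfolding E_G_a_def using Suc.prems
    by (auto simp: power_eq_1_iff d_eq simp del: power_Suc dest: dvd_imp_le)
  have "a \<noteq> 0"
    by (simp add: E_G_a_def z_nonzero)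
  have "1 - z ^ (2 * m + 1) = a * E"
    unfolding E_G_a_def by (rule inv) (use m in simp)
  moreover have "1 - z ^ (2 * m + 2) = - (z ^ (2 * m + 2)) * G"
    unfolding E_G_a_def by (rule inv) (use m in simp)
  \<comment> \<open>The two prefactors differ exactly by \<open>z\<close>, which raises
    \<open>z ^ k\<close> to \<open>z ^ Suc k\<close>.\<close>
  then have "1 - z ^ (2 * m + 2) = a * z * G"
    by (simp add: E_G_a_def)
  moreover have "cbin_ratio z (Suc m) = cbin_ratio z h * z ^ k * cbin_ratio z k"
    using Suc m by simp
  ultimately have "cbin_ratio z h * z ^ k * cbin_ratio z k * (a * z * G) = cbin_ratio z m * (a * E)"
    using cbin_ratio_Suc [OF m(2)] by simp
  moreover have "cbin_ratio z (Suc k) * E = cbin_ratio z k * G"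
    unfolding E_G_a_def by (rule cbin_ratio_Suc) (use Suc.prems in simp)
  ultimately have "cbin_ratio z m * (a * E) = cbin_ratio z h * z ^ Suc k * cbin_ratio z (Suc k) * (a * E)"
    by (metis (no_types, opaque_lifting) mult.assoc mult.commute power_Suc)
  then show ?case
    using \<open>E \<noteq> 0\<close> \<open>a \<noteq> 0\<close> by (simp add: m_def)
qed

text \<open>Outside \<open>0..h\<close> both sides vanish: one argument is negative, the other lies
  strictly between \<open>h\<close> and \<open>d\<close>.\<close>

lemma cbin_ratio_int_reflect:
  assumes "- int h \<le> c" "c \<le> 2 * int h"
  shows "cbin_ratio_int z (int h - c) = cbin_ratio z h * z powi c * cbin_ratio_int z c"
proof -
  consider "c < 0" | "0 \<le> c" "c \<le> int h" | "int h < c"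
    by linarith
  then show ?thesis
  proof cases
    case 1
    have "cbin_ratio z (nat (int h - c)) = 0"
      by (rule cbin_ratio_eq_0) (use 1 assms d_eq in auto)
    with 1 show ?thesis
      by (simp add: cbin_ratio_int_def)
  next
    case 2
    then show ?thesis
      using cbin_ratio_reflect [of "nat c"] by (simp add: cbin_ratio_int_def power_int_def nat_diff_distrib')
  next
    case 3
    have "cbin_ratio z (nat c) = 0"
      by (rule cbin_ratio_eq_0) (use 3 assms d_eq in auto)
    with 3 show ?thesis
      by (simp add: cbin_ratio_int_def)
  qed
qed

lemma cbin_ratio_half: "cbin_ratio z h * z ^ (h * (h + 1)) = (-1) ^ h"
proof -
  have pw: "(\<Prod>j<m. z ^ (2 * j + 2)) = z ^ (m * (m + 1))" for m
  proof (induction m)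
    case (Suc m)
    have "Suc m * (Suc m + 1) = m * (m + 1) + (2 * m + 2)"
      by simp
    with Suc show ?case
      by (simp only: prod.lessThan_Suc power_add)
  qed simp
  \<comment> \<open>Reverse the product and give each factor the power of \<open>z\<close>
    complementing its exponent to \<open>d\<close>: the numerator becomes the denominator up to the
    sign \<open>(-1) ^ h\<close>.\<close>
  have "q_poch z (z\<^sup>2) h * z ^ (h * (h + 1))
    = (\<Prod>j<h. 1 - z * (z\<^sup>2) ^ (h - Suc j)) * (\<Prod>j<h. z ^ (2 * j + 2))"
    unfolding pw prod.nat_diff_reindex [of "\<lambda>j. 1 - z * (z\<^sup>2) ^ j"] by (simp add: q_poch_def)
  also have "\<dots> = (\<Prod>j<h. (1 - z * (z\<^sup>2) ^ (h - Suc j)) * z ^ (2 * j + 2))"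
    by (simp add: prod.distrib)
  also have "\<dots> = (\<Prod>j<h. (-1) * (1 - z\<^sup>2 * (z\<^sup>2) ^ j))"
  proof (rule prod.cong)
    fix j assume "j \<in> {..<h}"
    then have "z * (z\<^sup>2) ^ (h - Suc j) * z ^ (2 * j + 2) = z ^ (1 + 2 * (h - Suc j) + (2 * j + 2))"
      by (simp only: power_add power_mult power_one_right)
    also have "1 + 2 * (h - Suc j) + (2 * j + 2) = d"
      using \<open>j \<in> {..<h}\<close> by (auto simp: d_eq)
    also have "z ^ d = 1"
      by (simp add: power_eq_1_iff)
    finally have *: "z * (z\<^sup>2) ^ (h - Suc j) * z ^ (2 * j + 2) = 1" .
    have "z ^ (2 * j + 2) = z\<^sup>2 * (z\<^sup>2) ^ j"
      by (simp add: power_mult power_add power2_eq_square)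
    with * show "(1 - z * (z\<^sup>2) ^ (h - Suc j)) * z ^ (2 * j + 2) = (-1) * (1 - z\<^sup>2 * (z\<^sup>2) ^ j)"
      by (simp only: left_diff_distrib) simp
  qed simp
  also have "\<dots> = (-1) ^ h * q_poch (z\<^sup>2) (z\<^sup>2) h"
    by (simp only: prod.distrib q_poch_def prod_constant card_lessThan)
  finally show ?thesis
    using q_poch_square_nonzero [of h]
    by (simp add: field_simps flip: q_poch_ratio [OF q_poch_square_nonzero [of h]])
qed

section \<open>Antisymmetric blocks and truncated sums\<close>

definition shifted_term :: "int \<Rightarrow> nat \<Rightarrow> 'a" where
  "shifted_term s k = (-1) ^ k * (\<Sum>i<4 * k + 1. z ^ i) * z ^ k *
     (cbin_ratio_int z (int k - s) * cbin_ratio_int z (int k + s) *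
      (cbin_ratio z k)\<^sup>2 * cbin_ratio (z\<^sup>2) k)"

lemma binom_term_eq_shifted_term: "s \<le> k \<Longrightarrow> binom_term s k z = shifted_term (int s) k"
  by (simp add: binom_term_def shifted_term_def cbin_ratio_int_def nat_diff_distrib' nat_add_distrib)

lemma shifted_term_eq_0: "k < s \<Longrightarrow> shifted_term (int s) k = 0"
  by (simp add: shifted_term_def cbin_ratio_int_def)

lemma geometric_sum: "(\<Sum>i<m. z ^ i) = (1 - z ^ m) / (1 - z)"
  using power_eq_1_iff [of 1] d_eq h_pos by (simp add: one_diff_power_eq)

lemma shifted_term_block:
  assumes "\<bar>t\<bar> \<le> int h"
  obtains K where
    "\<And>b. b < d \<Longrightarrow> shifted_term (int d * v + t) (d * u + b) = K * shifted_term t b"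
proof
  fix b assume b: "b < d"
  interpret sq: odd_primitive_root "z\<^sup>2" h d
    by (rule square)
  show "shifted_term (int d * v + t) (d * u + b) =
    ((-1) ^ u * block_factor_int (int u - v) * block_factor_int (int u + v)
      * (block_factor u)\<^sup>2 * sq.block_factor u) * shifted_term t b"
  \<comment> \<open>For \<open>b > h\<close> the arguments \<open>b + t\<close> and
    \<open>b - t\<close> may leave the range of \<open>cbin_ratio_int_block\<close>, but
    \<open>cbin_ratio z b = 0\<close> annihilates both sides.\<close>
  proof (cases "b \<le> h")
    case False
    then show ?thesis
      using b by (simp add: shifted_term_def cbin_ratio_block cbin_ratio_eq_0)
  next
    case True
    have sgn: "(-1 :: 'a) ^ (d * u + b) = (-1) ^ u * (-1) ^ b"
      by (simp add: power_add power_mult d_eq)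
    have pw: "z ^ (4 * (d * u + b) + 1) = z ^ (4 * b + 1)" "z ^ (d * u + b) = z ^ b"
      using power_eq_1_iff [of d] by (simp_all add: power_add power_mult distrib_left
          mult.left_commute [of 4])
    have c1: "int (d * u + b) - (int d * v + t) = int d * (int u - v) + (int b - t)"
      and c2: "int (d * u + b) + (int d * v + t) = int d * (int u + v) + (int b + t)"
      by (simp_all add: algebra_simps)
    have c: "cbin_ratio_int z (int (d * u + b) - (int d * v + t))
        = block_factor_int (int u - v) * cbin_ratio_int z (int b - t)"
      "cbin_ratio_int z (int (d * u + b) + (int d * v + t))
        = block_factor_int (int u + v) * cbin_ratio_int z (int b + t)"
      unfolding c1 c2 by (rule cbin_ratio_int_block; use True assms d_eq in auto)+
    show ?thesis
      unfolding shifted_term_def c cbin_ratio_block [OF b] sq.cbin_ratio_block [OF b]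
        geometric_sum pw sgn power_mult_distrib
      by (simp only: mult_ac times_divide_eq_right times_divide_eq_left)
  qed
qed

text \<open>Reflecting the five ratios produces the constant \<open>C ^ 4 * C'\<close> and the power
  \<open>z ^ (6 * b)\<close>. These combine with the reflected sign, bracket and power of
  \<open>z\<close> to leave a factor -1.\<close>

lemma shifted_term_reflect:
  assumes "\<bar>t\<bar> \<le> int h" "b \<le> h"
  shows "shifted_term t (h - b) = - shifted_term t b"
proof -
  interpret sq: odd_primitive_root "z\<^sup>2" h d
    by (rule square)
  define C where "C = cbin_ratio z h"
  define C' where "C' = cbin_ratio (z\<^sup>2) h"
  define c where "c = cbin_ratio_int z"
  have c1: "c (int (h - b) - t) = C * z powi (int b + t) * c (int b + t)"
    using cbin_ratio_int_reflect [of "int b + t"] assms by (simp add: c_def C_def algebra_simps)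
  have c2: "c (int (h - b) + t) = C * z powi (int b - t) * c (int b - t)"
    using cbin_ratio_int_reflect [of "int b - t"] assms by (simp add: c_def C_def algebra_simps)
  have "z powi (int b + t) * z powi (int b - t) = z powi (2 * int b)"
    using z_nonzero by (simp flip: power_int_add)
  then have pp: "z powi (int b + t) * z powi (int b - t) = (z ^ b)\<^sup>2"
    by (metis int_ops(7) numeral_One of_nat_numeral power_even_eq power_int_of_nat)
  have "c (int (h - b) - t) * c (int (h - b) + t)
      = C\<^sup>2 * (z powi (int b + t) * z powi (int b - t)) * (c (int b - t) * c (int b + t))"
    unfolding c1 c2 by (simp add: power2_eq_square mult_ac)
  then have c12: "c (int (h - b) - t) * c (int (h - b) + t)
      = C\<^sup>2 * (z ^ b)\<^sup>2 * (c (int b - t) * c (int b + t))"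
    unfolding pp .
  have c3: "cbin_ratio z (h - b) = C * z ^ b * cbin_ratio z b"
    unfolding C_def using assms by (simp add: cbin_ratio_reflect)
  have c4: "cbin_ratio (z\<^sup>2) (h - b) = C' * (z ^ b)\<^sup>2 * cbin_ratio (z\<^sup>2) b"
    unfolding C'_def using assms by (simp add: sq.cbin_ratio_reflect power_mult [symmetric] mult.commute)
  have zd: "z ^ (2 * h + 1) = 1"
    by (simp only: power_eq_1_iff d_eq dvd_refl)
  \<comment> \<open>Reflection at \<open>k = h\<close> returns to
    \<open>cbin_ratio z 0 = 1\<close>.\<close>
  have "C\<^sup>2 * z ^ h = 1"
    using cbin_ratio_reflect [of h] by (simp add: C_def power2_eq_square mult_ac) (simp add: cbin_ratio_def)
  \<comment> \<open>Here \<open>cbin_ratio_half\<close> is applied to the square of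
    \<open>z\<close>, with the exponent \<open>2 * h * (h + 1)\<close> reduced modulo
    \<open>d\<close>.\<close>
  moreover have "C' * z ^ h = (-1) ^ h"
  proof -
    have "(z\<^sup>2) ^ (h * (h + 1)) = (z ^ (2 * h + 1)) ^ h * z ^ h"
      by (simp add: algebra_simps flip: power_mult power_add)
    then show ?thesis
      using sq.cbin_ratio_half zd by (simp add: C'_def)
  qed
  ultimately have "(C\<^sup>2 * z ^ h) * (C\<^sup>2 * z ^ h) * (C' * z ^ h) = (-1) ^ h"
    by simp
  then have "C ^ 4 * C' * z ^ h * z ^ (2 * h + 1) = (-1) ^ h * z"
    by (simp add: mult_ac power_add mult_2 numeral_eq_Suc)
  then have D: "C ^ 4 * C' * z ^ h = (-1) ^ h * z"
    unfolding zd by simp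
  \<comment> \<open>The exponents \<open>4 * (h - b) + 1\<close> and \<open>4 * b + 1\<close> add up
    to \<open>2 * d\<close>; this is the source of the minus sign.\<close>
  have z4: "(1 - z ^ (4 * (h - b) + 1)) * z ^ (4 * b + 1) = - (1 - z ^ (4 * b + 1))"
  proof -
    have "z ^ (4 * (h - b) + 1) * z ^ (4 * b + 1) = z ^ (2 * (2 * h + 1))"
      using assms by (simp only: power_add [symmetric]) (simp add: algebra_simps)
    also have "\<dots> = 1"
      by (simp only: power_mult [of z "2 * h + 1"] zd mult.commute [of 2 "2 * h + 1"]) simp
    finally show ?thesis
      by (simp add: algebra_simps)
  qed
  define g g' e e' y w where defs: "g = 1 - z ^ (4 * b + 1)" "g' = 1 - z ^ (4 * (h - b) + 1)"
    "e = (-1 :: 'a) ^ b" "e' = (-1 :: 'a) ^ (h - b)" "y = z ^ b" "w = z ^ (h - b)"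
  have wy: "w * y = z ^ h" and e: "e' * (-1) ^ h = e"
    using assms by (simp_all add: defs minus_one_power_iff flip: power_add)
  have "y ^ 4 * z = z ^ (4 * b + 1)"
    by (simp add: defs mult.commute flip: power_mult)
  then have gy: "g' * (y ^ 4 * z) = - g"
    using z4 by (simp only: defs)
  have "e' * g' * w * (C ^ 4 * C' * y ^ 6) = e' * (C ^ 4 * C' * (w * y)) * g' * y ^ 5"
    by (simp add: numeral_eq_Suc mult_ac)
  also have "\<dots> = (e' * (-1) ^ h) * (g' * (y ^ 4 * z)) * y"
    unfolding wy D by (simp add: numeral_eq_Suc mult_ac)
  also have "\<dots> = - (e * g * y)"
    unfolding e gy by simp
  finally have main: "e' * g' * w * (C ^ 4 * C' * y ^ 6) = - (e * g * y)" .
  define P where "P = c (int b - t) * c (int b + t) * (cbin_ratio z b)\<^sup>2 * cbin_ratio (z\<^sup>2) b"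
  have "shifted_term t (h - b) = e' * (g' / (1 - z)) * w * (C\<^sup>2 * y\<^sup>2 *
      (c (int b - t) * c (int b + t)) * (C * y * cbin_ratio z b)\<^sup>2 * (C' * y\<^sup>2 * cbin_ratio (z\<^sup>2) b))"
    unfolding shifted_term_def geometric_sum defs c3 c4 c_def [symmetric] c12 by (rule refl)
  also have "\<dots> = (e' * g' * w * (C ^ 4 * C' * y ^ 6)) * (P / (1 - z))"
    by (simp add: P_def numeral_eq_Suc mult_ac)
  also have "\<dots> = - (e * (g / (1 - z)) * y * P)"
    unfolding main by simp
  also have "\<dots> = - shifted_term t b"
    unfolding shifted_term_def geometric_sum defs P_def c_def [symmetric] by (rule refl)
  finally show ?thesis .
qed

lemma sum_shifted_term_block:
  assumes "\<bar>t\<bar> \<le> int h"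
  shows "(\<Sum>b<d. shifted_term t b) = 0"
proof -
  let ?S = "\<Sum>b\<le>h. shifted_term t b"
  have "?S = (\<Sum>b\<le>h. shifted_term t (h - b))"
    by (rule sum.atLeastAtMost_rev [of _ 0 h, simplified atLeast0AtMost, simplified])
  also have "\<dots> = - ?S"
    using shifted_term_reflect [OF assms] by (simp add: sum_negf)
  finally have "2 * ?S = 0"
    by simp
  then have "?S = 0"
    by simp
  also have "?S = (\<Sum>b<d. shifted_term t b)"
    by (rule sum.mono_neutral_left)
      (use d_eq in \<open>auto simp: shifted_term_def cbin_ratio_eq_0\<close>)
  finally show ?thesis
    by simp
qed

lemma sum_shifted_term_blocks:
  assumes "\<bar>t\<bar> \<le> int h"
  shows "(\<Sum>k<d * w. shifted_term (int d * v + t) k) = 0"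
proof -
  have "(\<Sum>k\<in>{u * d..<u * d + d}. shifted_term (int d * v + t) k) = 0" for u
  proof -
    obtain K where K: "\<And>b. b < d \<Longrightarrow> shifted_term (int d * v + t) (d * u + b) = K * shifted_term t b"
      using shifted_term_block [OF assms] by blast
    have "(\<Sum>k\<in>{u * d..<u * d + d}. shifted_term (int d * v + t) k)
        = (\<Sum>b<d. shifted_term (int d * v + t) (d * u + b))"
      by (rule sum.reindex_bij_witness [of _ "\<lambda>b. d * u + b" "\<lambda>k. k - d * u"])
        (auto simp: mult.commute)
    also have "\<dots> = K * (\<Sum>b<d. shifted_term t b)"
      by (simp add: K sum_distrib_left)
    finally show ?thesis
      by (simp add: sum_shifted_term_block [OF assms])
  qed
  then show ?thesis
    using sum.nat_group [of "shifted_term (int d * v + t)" d w] by (simp add: mult.commute)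
qed

text \<open>If \<open>b < \<bar>t\<bar>\<close>, one of \<open>b - t\<close> and
  \<open>b + t\<close> is negative. These zeros account for the difference between an upper limit
  and the end of a block.\<close>

lemma shifted_term_residue_eq_0:
  assumes "\<bar>t\<bar> \<le> int h" "b < d" "h < b \<or> int b < \<bar>t\<bar>"
  shows "shifted_term (int d * v + t) (d * u + b) = 0"
proof -
  have "shifted_term t b = 0"
    using assms(2,3) by (auto simp: shifted_term_def cbin_ratio_eq_0 cbin_ratio_int_def)
  then show ?thesis
    using shifted_term_block [OF assms(1), of v u] assms(2) by (metis mult_zero_right)
qed

lemma sum_shifted_term_eq_0:
  assumes "n = d * m" "odd n" "s \<le> (n - 1) div 2"
    and "M \<in> {(n - 1) div 2, n - s - 1, n - 1}"
  shows "(\<Sum>k<Suc M. shifted_term (int s) k) = 0"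
proof -
  \<comment> \<open>Here \<open>t\<close> is the residue of \<open>s\<close> of least absolute
    value.\<close>
  obtain v t where vt: "int s = int d * int v + t" "\<bar>t\<bar> \<le> int h"
  proof (cases "s mod d \<le> h")
    case True
    show ?thesis
    proof (rule that)
      show "int s = int d * int (s div d) + int (s mod d)"
        by (simp flip: of_nat_mult of_nat_add)
    qed (use True in auto)
  next
    case False
    have "s mod d < d"
      by (simp add: d_eq)
    show ?thesis
    proof (rule that)
      have "int s = int d * int (s div d) + int (s mod d)"
        by (simp flip: of_nat_mult of_nat_add)
      then show "int s = int d * int (Suc (s div d)) + (int (s mod d) - int d)"
        by (simp add: algebra_simps)
      show "\<bar>int (s mod d) - int d\<bar> \<le> int h"
        using False \<open>s mod d < d\<close> unfolding d_eq by linarith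
    qed
  qed
  have zero: "(\<Sum>k<d * w. shifted_term (int s) k) = 0" for w
    unfolding vt(1) by (rule sum_shifted_term_blocks) fact
  have res: "shifted_term (int s) (d * u + b) = 0" if "b < d" "h < b \<or> int b < \<bar>t\<bar>" for u b
    unfolding vt(1) by (rule shifted_term_residue_eq_0) (use vt that in auto)
  have "odd m" "m > 0"
    using assms by (auto intro: Nat.gr0I)
  consider "M = (n - 1) div 2" | "M = n - s - 1" | "M = n - 1"
    using assms(4) by auto
  then show ?thesis
  proof cases
    case 1
    obtain m' where m': "m = 2 * m' + 1"
      using \<open>odd m\<close> by (rule oddE)
    \<comment> \<open>The last block is cut just after residue \<open>h\<close>, so only zero terms
      are missing.\<close>
    have M: "M = d * m' + h"
      unfolding 1 assms(1) m' d_eq by (simp add: algebra_simps)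
    have "(\<Sum>k<Suc M. shifted_term (int s) k) = (\<Sum>k<d * Suc m'. shifted_term (int s) k)"
    proof (rule sum.mono_neutral_left)
      show "\<forall>k\<in>{..<d * Suc m'} - {..<Suc M}. shifted_term (int s) k = 0"
      proof
        fix k assume "k \<in> {..<d * Suc m'} - {..<Suc M}"
        then have "k = d * m' + (k - d * m')" "k - d * m' < d" "h < k - d * m'"
          by (auto simp: M)
        then show "shifted_term (int s) k = 0"
          using res [of "k - d * m'" m'] by simp
      qed
    qed (auto simp: M d_eq)
    then show ?thesis
      by (simp only: zero)
  next
    case 2
    have "int (Suc M) = int n - int s"
      using 2 assms(2,3) odd_pos [OF assms(2)] by linarith
    then have M: "int (Suc M) = int (d * m) - int (d * v) - t"
      using vt assms(1) by simp
    \<comment> \<open>Otherwise \<open>s\<close> would be at least \<open>d * v - h\<close>,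
      incompatible with \<open>2 * s < n\<close>.\<close>
    have "v < m"
    proof (rule ccontr)
      assume "\<not> v < m"
      then have "d * m \<le> d * v" "d * 1 \<le> d * v"
        using \<open>m > 0\<close> by (auto intro!: mult_le_mono2)
      moreover have "2 * int s \<le> int (d * m) - 1"
        unfolding assms(1) [symmetric] using assms(3) odd_pos [OF assms(2)] by linarith
      moreover have "int s = int (d * v) + t"
        using vt(1) by simp
      ultimately show False
        using vt(2) d_eq by linarith
    qed
    then obtain w where w: "m = v + Suc w"
      by (metis less_imp_Suc_add add_Suc_right)
    have M: "int (Suc M) = int (d * Suc w) - t"
      unfolding M w by (simp add: algebra_simps)
    \<comment> \<open>For \<open>t \<ge> 0\<close> the range stops \<open>t\<close> terms before the
      end of a block, all missing residues exceeding \<open>h\<close>; for \<open>t < 0\<close> it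
      runs \<open>-t\<close> terms into the next block, at residues below \<open>-t\<close>.\<close>
    have "(\<Sum>k<Suc M. shifted_term (int s) k) = (\<Sum>k<d * Suc w. shifted_term (int s) k)"
    proof (cases "t \<ge> 0")
      case True
      then have "int (Suc M) \<le> int (d * Suc w)"
        using M by linarith
      then have "Suc M \<le> d * Suc w"
        by (simp only: of_nat_le_iff)
      show ?thesis
      proof (rule sum.mono_neutral_left)
        show "\<forall>k\<in>{..<d * Suc w} - {..<Suc M}. shifted_term (int s) k = 0"
        proof
          fix k assume k: "k \<in> {..<d * Suc w} - {..<Suc M}"
          then have "Suc M \<le> k" "k < d * w + d"
            by auto
          moreover from this have "d * w + h < k"
            using M vt(2) d_eq unfolding mult_Suc_right of_nat_add by linarith
          ultimately have "k = d * w + (k - d * w)" "k - d * w < d" "h < k - d * w"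
            by auto
          then show "shifted_term (int s) k = 0"
            using res [of "k - d * w" w] by simp
        qed
      qed (use \<open>Suc M \<le> d * Suc w\<close> in auto)
    next
      case False
      then have "int (d * Suc w) \<le> int (Suc M)"
        using M by linarith
      then have "d * Suc w \<le> Suc M"
        by (simp only: of_nat_le_iff)
      show ?thesis
      proof (rule sum.mono_neutral_right)
        show "\<forall>k\<in>{..<Suc M} - {..<d * Suc w}. shifted_term (int s) k = 0"
        proof
          fix k assume k: "k \<in> {..<Suc M} - {..<d * Suc w}"
          then have "k = d * Suc w + (k - d * Suc w)" "int (k - d * Suc w) < \<bar>t\<bar>"
            using M False by auto
          moreover from this have "k - d * Suc w < d"
            using vt d_eq by linarith
          ultimately show "shifted_term (int s) k = 0"
            using res [of "k - d * Suc w" "Suc w"] by simp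
        qed
      qed (use \<open>d * Suc w \<le> Suc M\<close> in auto)
    qed
    then show ?thesis
      by (simp only: zero)
  next
    case 3
    then have "Suc M = d * m"
      using assms(1) \<open>m > 0\<close> d_eq by simp
    then show ?thesis
      by (simp only: zero)
  qed
qed

lemma sum_binom_term_eq_0:
  assumes "d dvd n" "odd n" "s \<le> (n - 1) div 2"
    and "M \<in> {(n - 1) div 2, n - s - 1, n - 1}"
  shows "(\<Sum>k=s..M. binom_term s k z) = 0"
proof -
  have "(\<Sum>k=s..M. binom_term s k z) = (\<Sum>k=s..M. shifted_term (int s) k)"
    by (rule sum.cong) (simp_all add: binom_term_eq_shifted_term)
  also have "\<dots> = (\<Sum>k<Suc M. shifted_term (int s) k)"
    by (rule sum.mono_neutral_left) (auto simp: shifted_term_eq_0)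
  finally show ?thesis
    using assms sum_shifted_term_eq_0 by (auto elim!: dvdE)
qed

end

lemma odd_primitive_root_exists:
  fixes z :: "'a::field_char_0"
  assumes "z ^ n = 1" "z \<noteq> 1" "odd n"
  obtains h d where "odd_primitive_root z h d" "d dvd n"
proof -
  define d where "d = (LEAST j. 0 < j \<and> z ^ j = 1)"
  have "0 < n \<and> z ^ n = 1"
    using assms by (auto intro: Nat.gr0I)
  then have d: "0 < d \<and> z ^ d = 1"
    unfolding d_def by (rule LeastI)
  have min: "\<not> (0 < j \<and> z ^ j = 1)" if "j < d" for j
    using that unfolding d_def by (rule not_less_Least)
  have iff: "z ^ j = 1 \<longleftrightarrow> d dvd j" for j
  proof -
    have "z ^ j = (z ^ d) ^ (j div d) * z ^ (j mod d)"
      by (simp flip: power_mult power_add)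
    then have "z ^ j = z ^ (j mod d)"
      using d by simp
    then show ?thesis
      using min [of "j mod d"] d by (auto simp: dvd_eq_mod_eq_0)
  qed
  have "d dvd n"
    using iff assms by blast
  then have "odd d"
    using assms(3) by auto
  then obtain h where h: "d = 2 * h + 1"
    by (rule oddE)
  have "h > 0"
    using h d assms(2) by (auto intro: Nat.gr0I)
  with iff h have "odd_primitive_root z h d"
    by unfold_locales
  with \<open>d dvd n\<close> show ?thesis
    using that by blast
qed

section \<open>Passage to rational functions\<close>

locale unital_ring_hom =
  fixes f :: "'a::comm_ring_1 \<Rightarrow> 'b::comm_ring_1"
  assumes add [simp]: "f (x + y) = f x + f y"
    and mult [simp]: "f (x * y) = f x * f y"
    and one [simp]: "f 1 = 1"
begin

lemma zero [simp]: "f 0 = 0"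
  using add [of 0 0] by simp

lemma uminus [simp]: "f (- x) = - f x"
  using add [of x "- x"] by (simp add: eq_neg_iff_add_eq_0 add.commute)

lemma power [simp]: "f (x ^ n) = f x ^ n"
  by (induction n) simp_all

lemma sum [simp]: "f (sum g A) = (\<Sum>a\<in>A. f (g a))"
  by (induction A rule: infinite_finite_induct) simp_all

lemma prod [simp]: "f (prod g A) = (\<Prod>a\<in>A. f (g a))"
  by (induction A rule: infinite_finite_induct) simp_all

lemma gbin [simp]: "f (gbin q n k) = gbin (f q) n k"
  by (induction q n k rule: gbin.induct) simp_all

lemma one_plus_prod [simp]: "f (one_plus_prod q m) = one_plus_prod (f q) m"
  by (simp add: one_plus_prod_def)

end

text \<open>The common-denominator formula is stated in the ring, with division only in the target,
  so one pair of polynomials serves both the rational function and its value at a complex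
  number.\<close>

lemma sum_fractions_hom:
  fixes f :: "'a::comm_ring_1 \<Rightarrow> 'b::field"
  assumes "unital_ring_hom f" "finite A" "\<And>k. k \<in> A \<Longrightarrow> f (D k) \<noteq> 0"
  shows "f (\<Sum>k\<in>A. N k * (\<Prod>j\<in>A - {k}. D j)) / f (\<Prod>k\<in>A. D k) = (\<Sum>k\<in>A. f (N k) / f (D k))"
proof -
  interpret unital_ring_hom f
    by fact
  have "f (N k) * (\<Prod>j\<in>A - {k}. f (D j)) / (\<Prod>k\<in>A. f (D k)) = f (N k) / f (D k)"
    if "k \<in> A" for k
    using assms that by (simp add: prod.remove [of A k])
  then show ?thesis
    by (simp add: sum_divide_distrib)
qed

definition term_num :: "nat \<Rightarrow> nat \<Rightarrow> 'a::comm_ring_1 \<Rightarrow> 'a" where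
  "term_num s k q = (-1) ^ k * (\<Sum>i<4 * k + 1. q ^ i) * q ^ k *
     (gbin q (2 * (k - s)) (k - s) * gbin q (2 * (k + s)) (k + s) * (gbin q (2 * k) k)\<^sup>2 *
      gbin (q\<^sup>2) (2 * k) k)"

definition term_den :: "nat \<Rightarrow> nat \<Rightarrow> 'a::comm_ring_1 \<Rightarrow> 'a" where
  "term_den s k q = (one_plus_prod q (k - s) * one_plus_prod q (k + s) * (one_plus_prod q k)\<^sup>2 *
     one_plus_prod (q\<^sup>2) k)\<^sup>2"

lemma binom_term_eq_fraction: "binom_term s k q = term_num s k q / term_den s k q"
  by (simp add: binom_term_def term_num_def term_den_def cbin_ratio_def power_mult_distrib power_divide)

lemma (in unital_ring_hom) term_num_den:
  "f (term_num s k q) = term_num s k (f q)" "f (term_den s k q) = term_den s k (f q)"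
  unfolding term_num_def term_den_def by simp_all

lemma (in odd_primitive_root) term_den_nonzero: "term_den s k z \<noteq> 0"
  using odd_primitive_root.one_plus_prod_nonzero [OF square]
  by (simp add: term_den_def one_plus_prod_nonzero)

lemma unital_ring_hom_to_fract: "unital_ring_hom (to_fract :: 'a::idom \<Rightarrow> 'a fract)"
  by unfold_locales simp_all

section \<open>Divisibility and coprimality in the polynomial ring\<close>

definition rat_eval :: "complex \<Rightarrow> rat poly \<Rightarrow> complex" where
  "rat_eval z p = poly (map_poly of_rat p) z"

lemma rat_eval_pCons [simp]: "rat_eval z (pCons a p) = of_rat a + z * rat_eval z p"
  by (simp add: rat_eval_def map_poly_pCons)

lemma rat_eval_0 [simp]: "rat_eval z 0 = 0"
  by (simp add: rat_eval_def)

lemma rat_eval_add: "rat_eval z (p + q) = rat_eval z p + rat_eval z q"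
  by (induction p q rule: poly_induct2) (simp_all add: of_rat_add algebra_simps)

lemma rat_eval_smult: "rat_eval z (smult a p) = of_rat a * rat_eval z p"
  by (induction p) (simp_all add: of_rat_mult algebra_simps)

lemma rat_eval_mult: "rat_eval z (p * q) = rat_eval z p * rat_eval z q"
  by (induction p) (simp_all add: rat_eval_add rat_eval_smult algebra_simps)

lemma unital_ring_hom_rat_eval: "unital_ring_hom (rat_eval z)"
  by unfold_locales (simp_all add: rat_eval_add rat_eval_mult one_pCons)

lemma degree_X_power: "degree ([:0, 1 :: 'a::idom:] ^ n) = n"
  by (simp add: degree_power_eq)

lemma q_bracket_poly_mult: "(1 - [:0, 1 :: rat:]) * q_bracket [:0, 1:] n = 1 - [:0, 1:] ^ n"
  unfolding q_bracket_poly by (rule one_diff_power_eq [symmetric])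

text \<open>The factor \<open>1 - X\<close> supplies the missing root 1. The remainder of
  \<open>(1 - X) * P\<close> modulo \<open>1 - X ^ n\<close> then has \<open>n\<close> distinct
  complex roots but degree below \<open>n\<close>, so it is zero, and \<open>1 - X\<close>
  cancels.\<close>

lemma q_bracket_dvd:
  assumes "n > 0" and root: "\<And>z. z ^ n = 1 \<Longrightarrow> z \<noteq> 1 \<Longrightarrow> rat_eval z P = 0"
  shows "q_bracket [:0, 1:] n dvd P"
proof -
  interpret unital_ring_hom "rat_eval z" for z
    by (rule unital_ring_hom_rat_eval)
  let ?X = "[:0, 1 :: rat:]"
  let ?U = "1 - ?X ^ n"
  define R where "R = ((1 - ?X) * P) mod ?U"
  have deg: "degree ?U = n"
    using degree_add_eq_right [of 1 "- (?X ^ n)"] assms(1) by (simp add: degree_X_power)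
  have X: "rat_eval z ?X = z" for z
    by simp
  have vanish: "rat_eval z R = 0" if "z ^ n = 1" for z
  proof -
    have "R = (1 - ?X) * P + - (?U * (((1 - ?X) * P) div ?U))"
      unfolding R_def by (simp add: minus_mult_div_eq_mod)
    then have "rat_eval z R = (1 - z) * rat_eval z P - (1 - z ^ n) * rat_eval z (((1 - ?X) * P) div ?U)"
      by (simp only: add mult uminus one power X diff_conv_add_uminus)
    then show ?thesis
      using root [OF that] that by (cases "z = 1") auto
  qed
  have "R = 0"
  proof (rule ccontr)
    assume "R \<noteq> 0"
    let ?R = "map_poly (of_rat :: rat \<Rightarrow> complex) R"
    have R: "?R \<noteq> 0" "degree ?R = degree R"
      using \<open>R \<noteq> 0\<close> by (simp_all add: map_poly_eq_0_iff degree_map_poly)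
    have "n = card {z::complex. z ^ n = 1}"
      using assms(1) by (simp add: card_roots_unity_eq)
    also have "\<dots> \<le> card {z. poly ?R z = 0}"
      by (rule card_mono) (use R vanish in \<open>auto simp: rat_eval_def poly_roots_finite\<close>)
    also have "\<dots> \<le> degree R"
      using card_poly_roots_bound [OF R(1)] R(2) by simp
    finally have "n \<le> degree R" .
    moreover have "?U \<noteq> 0"
      using deg assms(1) by force
    then have "degree R < n"
      using degree_mod_less [of ?U "(1 - ?X) * P"] \<open>R \<noteq> 0\<close> unfolding R_def deg by blast
    ultimately show False
      by simp
  qed
  then have "(1 - ?X) * q_bracket ?X n dvd (1 - ?X) * P"
    unfolding q_bracket_poly_mult by (simp add: R_def dvd_eq_mod_eq_0)
  moreover have "1 - ?X \<noteq> 0"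
    by (simp add: one_pCons)
  ultimately show ?thesis
    by (simp only: dvd_mult_cancel_left simp_thms)
qed

text \<open>A common divisor divides both \<open>1 + X ^ (j * n)\<close> and
  \<open>1 - X ^ (j * n)\<close>, hence their sum 2, a unit over the rationals.\<close>

lemma coprime_one_plus_power_q_bracket:
  assumes "odd n"
  shows "coprime (1 + [:0, 1:] ^ j) (q_bracket [:0, 1 :: rat:] n)"
proof (rule coprimeI)
  let ?X = "[:0, 1 :: rat:]"
  fix c
  assume c: "c dvd 1 + ?X ^ j" "c dvd q_bracket ?X n"
  have "1 - (- (?X ^ j)) ^ n = (1 - (- (?X ^ j))) * (\<Sum>i<n. (- (?X ^ j)) ^ i)"
    by (rule one_diff_power_eq)
  then have "1 + (?X ^ j) ^ n = (1 + ?X ^ j) * (\<Sum>i<n. (- (?X ^ j)) ^ i)"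
    by (simp only: power_minus_odd [OF assms] diff_minus_eq_add)
  then have "1 + ?X ^ j dvd 1 + ?X ^ (j * n)"
    unfolding power_mult by (rule dvdI)
  with c(1) have 1: "c dvd 1 + ?X ^ (j * n)"
    by (rule dvd_trans)
  have "q_bracket ?X n dvd 1 - ?X ^ n"
    unfolding q_bracket_poly_mult [symmetric] by (rule dvd_triv_right)
  moreover have "1 - ?X ^ n dvd 1 - ?X ^ (j * n)"
    unfolding mult.commute [of j] power_mult one_diff_power_eq [of "?X ^ n"] by (rule dvd_triv_left)
  ultimately have "c dvd 1 - ?X ^ (j * n)"
    using c(2) by (blast intro: dvd_trans)
  from dvd_add [OF 1 this] have "c dvd 1 + 1"
    by (simp only: add_diff_eq diff_add_eq add.assoc [symmetric] add_diff_cancel_right' add.commute)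
  then have "c dvd [:2:]"
    by (simp add: one_pCons)
  moreover have "1 = [:2 :: rat:] * [:1 / 2:]"
    by (simp add: one_pCons)
  then have "is_unit [:2 :: rat:]"
    by (rule dvdI)
  ultimately show "is_unit c"
    by (rule dvd_unit_imp_unit)
qed

lemma coprime_term_den:
  assumes "odd n"
  shows "coprime (term_den s k [:0, 1:]) (q_bracket [:0, 1 :: rat:] n)"
proof -
  have "coprime (one_plus_prod ([:0, 1:] ^ i) m) (q_bracket [:0, 1 :: rat:] n)" for i m
    unfolding one_plus_prod_def power_mult [symmetric]
    by (intro prod_coprime_left coprime_one_plus_power_q_bracket assms)
  from this [of 1] this [of 2] show ?thesis
    by (simp add: term_den_def)
qed

lemma term_den_poly_nonzero: "term_den s k [:0, 1 :: rat:] \<noteq> 0"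
proof -
  have *: "1 + ([:0, 1 :: rat:] ^ i) ^ j \<noteq> 0" for i j
  proof
    assume "1 + ([:0, 1 :: rat:] ^ i) ^ j = 0"
    \<comment> \<open>The value at 1 is 2.\<close>
    then have "poly (1 + ([:0, 1 :: rat:] ^ i) ^ j) 1 = 0"
      by simp
    then show False
      by (simp add: poly_power)
  qed
  have "one_plus_prod ([:0, 1 :: rat:] ^ i) m \<noteq> 0" for i m
    unfolding one_plus_prod_def using * by (simp del: power_Suc)
  from this [of 1] this [of 2] show ?thesis
    by (simp add: term_den_def)
qed

text \<open>Allows an unreduced fraction: the cancelled gcd divides \<open>Q\<close>, hence is
  coprime to \<open>M\<close>, so \<open>M\<close> still divides the reduced numerator.\<close>

lemma ratfun_cong_0I:
  assumes "Q \<noteq> 0" "coprime Q M" "M dvd P"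
  shows "ratfun_cong_0 (to_fract P / to_fract Q) M"
proof -
  obtain P' Q' where PQ: "P = P' * gcd P Q" "Q = Q' * gcd P Q" "coprime P' Q'"
    using gcd_coprime_exists [of P Q] assms(1) by auto
  have "coprime Q' M" "coprime (gcd P Q) M"
    using assms(2) by (metis PQ(2) coprime_mult_left_iff)+
  then have "M dvd P'"
    using assms(3) PQ(1) by (metis coprime_commute coprime_dvd_mult_left_iff)
  moreover have "Q' \<noteq> 0"
    using assms(1) PQ(2) by auto
  moreover have "P * Q' = P' * Q"
    using PQ(1,2) by (metis mult.assoc mult.commute)
  then have "to_fract P * to_fract Q' = to_fract P' * to_fract Q"
    by (simp only: to_fract_mult [symmetric])
  then have "to_fract P / to_fract Q = to_fract P' / to_fract Q'"
    using assms(1) \<open>Q' \<noteq> 0\<close> by (simp add: frac_eq_eq)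
  ultimately show ?thesis
    unfolding ratfun_cong_0_def using PQ(3) \<open>coprime Q' M\<close> by blast
qed

lemma q_var_power_neq_1:
  assumes "0 < j"
  shows "q_var ^ j \<noteq> 1"
proof
  interpret unital_ring_hom "to_fract :: rat poly \<Rightarrow> _"
    by (rule unital_ring_hom_to_fract)
  assume "q_var ^ j = 1"
  then have "to_fract ([:0, 1 :: rat:] ^ j) = to_fract 1"
    by simp
  then have "[:0, 1 :: rat:] ^ j = 1"
    by (simp only: to_fract_eq_iff)
  then have "degree ([:0, 1 :: rat:] ^ j) = 0"
    by simp
  with assms show False
    by (simp add: degree_X_power)
qed

theorem theorem2:
  fixes n s M :: nat
  assumes "n > 1" and "odd n"
    and "s \<le> (n - 1) div 2"
    and "M \<in> {(n - 1) div 2, n - s - 1, n - 1}"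
  shows "ratfun_cong_0 (\<Sum>k=s..M. T_term s k q_var) (q_bracket [:0, 1:] n)"
proof -
  let ?X = "[:0, 1 :: rat:]"
  define P where "P = (\<Sum>k=s..M. term_num s k ?X * (\<Prod>j\<in>{s..M} - {k}. term_den s j ?X))"
  define Q where "Q = (\<Prod>k=s..M. term_den s k ?X)"
  have "to_fract P / to_fract Q = (\<Sum>k=s..M. to_fract (term_num s k ?X) / to_fract (term_den s k ?X))"
    unfolding P_def Q_def
    by (rule sum_fractions_hom [OF unital_ring_hom_to_fract]) (simp_all add: term_den_poly_nonzero)
  also have "\<dots> = (\<Sum>k=s..M. T_term s k q_var)"
    by (simp add: T_term_eq_binom_term q_var_power_neq_1 binom_term_eq_fraction
        unital_ring_hom.term_num_den [OF unital_ring_hom_to_fract])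
  finally have "(\<Sum>k=s..M. T_term s k q_var) = to_fract P / to_fract Q" ..
  moreover have "Q \<noteq> 0"
    by (simp add: Q_def term_den_poly_nonzero)
  moreover have "coprime Q (q_bracket ?X n)"
    unfolding Q_def by (intro prod_coprime_left coprime_term_den assms)
  moreover have "q_bracket ?X n dvd P"
  proof (rule q_bracket_dvd)
    fix z :: complex
    assume z: "z ^ n = 1" "z \<noteq> 1"
    obtain h d where "odd_primitive_root z h d" "d dvd n"
      using odd_primitive_root_exists [OF z assms(2)] .
    interpret odd_primitive_root z h d
      by fact
    interpret ev: unital_ring_hom "rat_eval z"
      by (rule unital_ring_hom_rat_eval)
    have hom: "rat_eval z (term_num s k ?X) = term_num s k z"
      "rat_eval z (term_den s k ?X) = term_den s k z" for k
      by (simp_all add: ev.term_num_den)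
    \<comment> \<open>The denominator does not vanish at \<open>z\<close>, so a zero sum forces a
      zero numerator.\<close>
    have "rat_eval z P / rat_eval z Q = (\<Sum>k=s..M. binom_term s k z)"
      unfolding P_def Q_def binom_term_eq_fraction hom [symmetric]
      by (rule sum_fractions_hom [OF unital_ring_hom_rat_eval]) (simp_all add: hom term_den_nonzero)
    also have "\<dots> = 0"
      using \<open>d dvd n\<close> assms(2-4) by (rule sum_binom_term_eq_0)
    finally show "rat_eval z P = 0"
      by (simp add: Q_def hom term_den_nonzero)
  qed (use assms in simp)
  ultimately show ?thesis
    by (simp only:) (rule ratfun_cong_0I)
qed

end
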